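(* For every integer $k \geq 2$, as formal power series in $q$, \[ \sum_{n = 1}^\infty \mathrm{FFW}_k (n) q^n = \sum_{n = 1}^\infty \mathrm{FFW}_{k - 1} (n) q^n + (-1)^{k - 1} q^{k(k - 1)/2} \sum_{n = k}^\infty \begin{bmatrix} n-1 \\ k-1\end{bmatrix}_q \big((q^n;q)_\infty - 1\big) - (-1)^{k - 1} q^{(k - 1)(k - 2)/2} \sum_{n = k - 1}^\infty \begin{bmatrix} n-1 \\ k-2\end{bmatrix}_q nq^n. \]
   Context: For a positive integer $n$, $\mathcal{D}(n)$ denotes the set of partitions of $n$ into distinct parts; for $\pi \in \mathcal{D}(n)$, $\#(\pi)$ is the number of parts and $s_k(\pi)$ is the $k$th smallest part, with $s_k(\pi)=0$ if $\pi$ has fewer than $k$ parts. $\mathrm{FFW}_k(n) := \sum_{\pi \in \mathcal{D}(n)} (-1)^{\#(\pi)} s_k(\pi)$. Here $(a;q)_\infty=\prod_{i\ge0}(1-aq^i)$, $(q;q)_n=(1-q)\cdots(1-q^n)$, and $\begin{bmatrix} n \\ r\end{bmatrix}_q = \frac{(q;q)_n}{(q;q)_r (q;q)_{n-r}}$ for $n\ge r\ge0$, $0$ for $n<r$. *)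

theory Defs
  imports "HOL-Analysis.Analysis"
begin

section \<open>Partitions into distinct parts\<close>

text \<open>A partition into distinct parts is encoded by the finite set of its parts.\<close>

definition distinct_partitions :: "nat \<Rightarrow> nat set set" where
  "distinct_partitions n = {P. finite P \<and> 0 \<notin> P \<and> \<Sum>P = n}"

text \<open>The \<open>k\<close>-th smallest part, counted from \<open>k = 1\<close>; only \<open>k \<ge> 1\<close> is meaningful.\<close>

definition smallest_part :: "nat \<Rightarrow> nat set \<Rightarrow> nat" where
  "smallest_part k P = (if card P < k then 0 else sorted_list_of_set P ! (k - 1))"

definition FFW :: "nat \<Rightarrow> nat \<Rightarrow> int" where
  "FFW k n = (\<Sum>P\<in>distinct_partitions n. (-1) ^ card P * int (smallest_part k P))"

lemma finite_distinct_partitions: "finite (distinct_partitions n)"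
proof (rule finite_subset)
  show "distinct_partitions n \<subseteq> Pow {..n}"
  proof
    fix P assume "P \<in> distinct_partitions n"
    then have P: "finite P" "\<Sum>P = n"
      by (simp_all add: distinct_partitions_def)
    have "x \<le> n" if "x \<in> P" for x
      using member_le_sum[OF that, of "\<lambda>x. x"] P by simp
    then show "P \<in> Pow {..n}" by auto
  qed
qed simp

text \<open>The index \<open>n\<close> ranges over positive integers, so the constant term is \<open>0\<close>.\<close>

definition FFW_gf :: "nat \<Rightarrow> rat fps" where
  "FFW_gf k = Abs_fps (\<lambda>n. if n = 0 then 0 else of_int (FFW k n))"


section \<open>\<open>q\<close>-series\<close>

text \<open>
  The indeterminate \<open>q\<close> is \<^const>\<open>fps_X\<close>. Coefficients are rational so that the quotient
  in the Gaussian binomial is division by an invertible power series. Infinite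
  sums and products are limits in the \<open>q\<close>-adic topology of the library.
\<close>

definition qpoch_fin :: "nat \<Rightarrow> rat fps" where
  "qpoch_fin n = (\<Prod>i=1..n. 1 - fps_X ^ i)"

definition qpoch_inf :: "rat fps \<Rightarrow> rat fps" where
  "qpoch_inf a = (\<Prod>i. 1 - a * fps_X ^ i)"

definition qbinom :: "nat \<Rightarrow> nat \<Rightarrow> rat fps" where
  "qbinom n r = (if r \<le> n then qpoch_fin n / (qpoch_fin r * qpoch_fin (n - r)) else 0)"


section \<open>Convergence\<close>

text \<open>
  The library's infinite products and sums are only meaningful when they
  converge; the following facts show that all those used here do.
\<close>

lemma qpoch_inf_has_prod:
  assumes "fps_nth a 0 = 0"
  shows "(\<lambda>i. 1 - a * fps_X ^ i) has_prod qpoch_inf a"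
    and "(\<lambda>N. \<Prod>i\<le>N. 1 - a * fps_X ^ i) \<longlonglongrightarrow> qpoch_inf a"
proof -
  define P where "P = (\<lambda>N. \<Prod>i\<le>N. 1 - a * fps_X ^ i)"
  define L where "L = Abs_fps (\<lambda>m. fps_nth (P m) m)"
  have Suc: "P (Suc N) = P N - (P N * a) * fps_X ^ Suc N" for N
    by (simp add: P_def algebra_simps)
  have stable: "fps_nth (P N) m = fps_nth (P m) m" if "m \<le> N" for m N
    using that
  proof (induction N rule: dec_induct)
    case (step N)
    have "fps_nth (P (Suc N)) m = fps_nth (P N) m"
      unfolding Suc fps_sub_nth fps_X_power_mult_right_nth using step by simp
    with step show ?case by simp
  qed simp
  have lim: "P \<longlonglongrightarrow> L"
    unfolding L_def
    by (intro tendsto_fpsI, unfold fps_nth_Abs_fps, rule eventually_sequentiallyI, rule stable)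
  have "fps_nth L 0 = 1"
    using assms by (simp add: L_def P_def)
  then have "L \<noteq> 0" by auto
  with lim have hp: "(\<lambda>i. 1 - a * fps_X ^ i) has_prod L"
    by (simp add: has_prod_def raw_has_prod_def P_def)
  then have "qpoch_inf a = L"
    unfolding qpoch_inf_def using has_prod_unique by metis
  with hp lim show "(\<lambda>i. 1 - a * fps_X ^ i) has_prod qpoch_inf a"
    and "(\<lambda>N. \<Prod>i\<le>N. 1 - a * fps_X ^ i) \<longlonglongrightarrow> qpoch_inf a"
    by (simp_all add: P_def)
qed

lemma fps_nth_qpoch_inf_minus_1:
  assumes "m < n"
  shows "fps_nth (qpoch_inf (fps_X ^ n) - 1) m = 0"
proof -
  define P :: "nat \<Rightarrow> rat fps" where "P = (\<lambda>N. \<Prod>i\<le>N. 1 - fps_X ^ n * fps_X ^ i)"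
  have "fps_nth (P N) m = fps_nth 1 m" for N
  proof (induction N)
    case 0
    show ?case using assms by (simp add: P_def)
  next
    case (Suc N)
    have "P (Suc N) = P N - (P N * fps_X ^ Suc N) * fps_X ^ n"
      by (simp add: P_def algebra_simps)
    then show ?case
      using Suc assms by (simp add: fps_X_power_mult_right_nth del: power_Suc)
  qed
  moreover have "P \<longlonglongrightarrow> qpoch_inf (fps_X ^ n)"
    unfolding P_def using assms by (intro qpoch_inf_has_prod) auto
  then have "eventually (\<lambda>N. P N \<in> {H. fps_cutoff (Suc m) H = fps_cutoff (Suc m) (qpoch_inf (fps_X ^ n))}) sequentially"
    by (rule topological_tendstoD[OF _ open_fps_cutoff]) simp
  then obtain N where "fps_cutoff (Suc m) (P N) = fps_cutoff (Suc m) (qpoch_inf (fps_X ^ n))"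
    by (auto simp: eventually_at_top_linorder)
  then have "fps_nth (P N) m = fps_nth (qpoch_inf (fps_X ^ n)) m"
    by (auto simp: fps_eq_iff dest!: spec[of _ m])
  ultimately show ?thesis by simp
qed

lemma summable_fps:
  fixes f :: "nat \<Rightarrow> 'a :: ab_group_add fps"
  assumes "\<And>m n. m < n \<Longrightarrow> fps_nth (f n) m = 0"
  shows "summable f"
proof -
  have stable: "fps_nth (\<Sum>n<N. f n) m = fps_nth (\<Sum>n<Suc m. f n) m" if "Suc m \<le> N" for m N
    using that
  proof (induction N rule: dec_induct)
    case (step N)
    have "fps_nth (\<Sum>n<Suc N. f n) m = fps_nth (\<Sum>n<N. f n) m"
      using assms[of m N] step.hyps by simp
    then show ?case using step.IH by (rule trans)
  qed simp
  have "(\<lambda>N. \<Sum>n<N. f n) \<longlonglongrightarrow> Abs_fps (\<lambda>m. fps_nth (\<Sum>n<Suc m. f n) m)"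
    by (intro tendsto_fpsI, unfold fps_nth_Abs_fps, rule eventually_sequentiallyI, rule stable)
  then show ?thesis
    by (auto simp: summable_def sums_def)
qed

lemma summable_qbinom_qpoch_inf:
  "summable (\<lambda>n. qbinom (n + k - 1) (k - 1) * (qpoch_inf (fps_X ^ (n + k)) - 1))"
  by (rule summable_fps)
     (auto simp: fps_mult_nth fps_nth_qpoch_inf_minus_1 simp del: fps_sub_nth intro!: sum.neutral)

lemma summable_qbinom_qpow:
  "summable (\<lambda>n. qbinom (n + (k - 1) - 1) (k - 2) * (of_nat (n + (k - 1)) * fps_X ^ (n + (k - 1))))"
  by (rule summable_fps) (simp add: mult.assoc[symmetric] fps_X_power_mult_right_nth)

end

(* Write s_k(P) for the k-th smallest element of P. If P has at least k elements, then
   s_k(P) - s_{k-1}(P) is the number of n such that exactly k - 1 elements of P lie below n;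
   such a P splits at n into a (k-1)-subset of {1, ..., n-1}, counted by a Gaussian binomial,
   and a nonempty set of integers >= n, counted by (q^n; q)_inf - 1. If P has exactly k - 1 elements,
   the difference is -max P, and removing the maximum n leaves a (k-2)-subset of {1, ..., n-1}.
   To compare coefficients of q^N it suffices to consider P inside {1, ..., N}. *)

theory Submission
  imports Defs
begin

section \<open>Generating functions of subsets and Gaussian binomials\<close>

text \<open>For finite \<open>S\<close> this is the elementary symmetric polynomial of degree
  \<open>r\<close> in the powers \<open>fps_X ^ i\<close> with \<open>i\<close> in
  \<open>S\<close>.\<close>

definition subset_gf :: "nat \<Rightarrow> nat set \<Rightarrow> rat fps" where
  "subset_gf r S = (\<Sum>A | A \<subseteq> S \<and> card A = r. fps_X ^ \<Sum>A)"

lemma subset_gf_0: "finite S \<Longrightarrow> subset_gf 0 S = 1"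
proof -
  assume "finite S"
  then have "{A. A \<subseteq> S \<and> card A = 0} = {{}}"
    by (auto dest: finite_subset)
  then show ?thesis by (simp add: subset_gf_def)
qed

lemma subset_gf_eq_0:
  assumes "finite S" "card S < r"
  shows "subset_gf r S = 0"
proof -
  have "{A. A \<subseteq> S \<and> card A = r} = {}"
    using assms card_mono leD by blast
  then show ?thesis by (simp only: subset_gf_def sum.empty)
qed

text \<open>A Pascal-type recurrence: a subset of \<open>insert x S\<close> either avoids
  \<open>x\<close>, or arises from a subset of \<open>S\<close> by adding \<open>x\<close>, which
  raises its sum by \<open>x\<close>.\<close>

lemma subset_gf_insert:
  assumes "finite S" "x \<notin> S"
  shows "subset_gf (Suc r) (insert x S) = subset_gf (Suc r) S + fps_X ^ x * subset_gf r S"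
proof -
  have *: "{A. A \<subseteq> insert x S \<and> card A = Suc r}
      = {A. A \<subseteq> S \<and> card A = Suc r} \<union> insert x ` {A. A \<subseteq> S \<and> card A = r}" (is "?L = ?R")
  proof (intro equalityI subsetI)
    fix A assume A: "A \<in> ?L"
    then have fin: "finite A" using assms(1) finite_subset by auto
    show "A \<in> ?R"
    proof (cases "x \<in> A")
      case True
      then have "A = insert x (A - {x})" "A - {x} \<subseteq> S" "card (A - {x}) = r"
        using A fin by (auto simp: card_Diff_singleton)
      then show ?thesis by blast
    qed (use A in auto)
  next
    fix A assume "A \<in> ?R"
    then show "A \<in> ?L"
      using assms by (auto intro!: card_insert_disjoint dest: finite_subset)
  qed
  have inj: "inj_on (insert x) {A. A \<subseteq> S \<and> card A = r}"
    using assms(2) by (intro inj_onI) (metis insert_ident mem_Collect_eq subsetD)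
  have "subset_gf (Suc r) (insert x S) = subset_gf (Suc r) S
      + (\<Sum>A\<in>insert x ` {A. A \<subseteq> S \<and> card A = r}. fps_X ^ \<Sum>A)"
    unfolding subset_gf_def * using assms by (intro sum.union_disjoint) auto
  also have "(\<Sum>A\<in>insert x ` {A. A \<subseteq> S \<and> card A = r}. fps_X ^ \<Sum>A)
      = (\<Sum>A | A \<subseteq> S \<and> card A = r. fps_X ^ x * fps_X ^ \<Sum>A :: rat fps)"
    unfolding sum.reindex[OF inj] o_def
  proof (rule sum.cong)
    fix A assume "A \<in> {A. A \<subseteq> S \<and> card A = r}"
    then have "finite A" "x \<notin> A" using assms finite_subset by auto
    then show "fps_X ^ \<Sum>(insert x A) = fps_X ^ x * (fps_X ^ \<Sum>A :: rat fps)"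
      by (simp add: power_add)
  qed simp
  finally show ?thesis
    by (simp add: subset_gf_def sum_distrib_left)
qed

text \<open>Induction on \<open>m\<close> by the Pascal-type recurrence, with denominators cleared
  so that no division occurs. Writing \<open>q\<close> for \<open>fps_X\<close> and
  \<open>r = s + 1\<close>, the induction step reduces to \<open>q^(s+1) (1 - q^(m-s)) + q^(m+1) (1
  - q^(s+1)) = q^(s+1) (1 - q^(m+1))\<close>.\<close>

lemma subset_gf_mult_qpoch_fin:
  "r \<le> m \<Longrightarrow> subset_gf r {1..m} * (qpoch_fin r * qpoch_fin (m - r))
    = fps_X ^ (r * (r + 1) div 2) * qpoch_fin m"
proof (induction m arbitrary: r)
  case 0
  then show ?case by (simp add: subset_gf_0 qpoch_fin_def)
next
  case (Suc m)
  have q_Suc: "qpoch_fin (Suc n) = qpoch_fin n * (1 - fps_X ^ Suc n)" for n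
    by (simp add: qpoch_fin_def)
  show ?case
  proof (cases r)
    case 0
    then show ?thesis by (simp add: subset_gf_0 qpoch_fin_def)
  next
    case (Suc s)
    define T :: "rat fps" where "T = fps_X ^ (s * (s + 1) div 2)"
    have T: "fps_X ^ (r * (r + 1) div 2) = T * fps_X ^ Suc s"
    proof -
      have "r * (r + 1) div 2 = s * (s + 1) div 2 + Suc s"
        using Suc by simp
      then show ?thesis by (simp only: T_def power_add)
    qed
    have IH: "subset_gf s {1..m} * (qpoch_fin s * qpoch_fin (m - s)) = T * qpoch_fin m"
      unfolding T_def using Suc.prems \<open>r = Suc s\<close> by (intro Suc.IH) simp
    have rec: "subset_gf r {1..Suc m} = subset_gf r {1..m} + fps_X ^ Suc m * subset_gf s {1..m}"
      using subset_gf_insert[of "{1..m}" "Suc m" s] Suc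
      by (simp add: atLeastAtMostSuc_conv)
    \<comment> \<open>The factor \<open>qpoch_fin (m - s)\<close> in place of
      \<open>qpoch_fin (m - r)\<close> lets the formula include \<open>r = m + 1\<close>: there the
      left side vanishes for want of subsets, and the right side because
      \<open>m - s = 0\<close>.\<close>
    have *: "subset_gf r {1..m} * (qpoch_fin r * qpoch_fin (m - s))
        = T * fps_X ^ Suc s * qpoch_fin m * (1 - fps_X ^ (m - s))"
    proof (cases "r \<le> m")
      case True
      then have "m - s = Suc (m - r)" using Suc by simp
      then have "qpoch_fin (m - s) = qpoch_fin (m - r) * (1 - fps_X ^ (m - s))"
        by (simp only: q_Suc)
      then show ?thesis using Suc.IH[OF True] unfolding T by (simp add: mult_ac)
    next
      case False
      then have "m = s" using Suc Suc.prems by simp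
      with False show ?thesis by (simp add: subset_gf_eq_0)
    qed
    have X: "fps_X ^ Suc s * fps_X ^ (m - s) = (fps_X ^ Suc m :: rat fps)"
      using Suc Suc.prems by (simp flip: power_add)
    have "subset_gf r {1..Suc m} * (qpoch_fin r * qpoch_fin (Suc m - r))
       = subset_gf r {1..m} * (qpoch_fin r * qpoch_fin (m - s))
         + fps_X ^ Suc m * (subset_gf s {1..m} * (qpoch_fin s * qpoch_fin (m - s))) * (1 - fps_X ^ Suc s)"
      unfolding rec using Suc by (simp add: q_Suc algebra_simps del: power_Suc)
    also have "\<dots> = T * qpoch_fin m * (fps_X ^ Suc s - fps_X ^ Suc s * fps_X ^ (m - s)
         + fps_X ^ Suc m - fps_X ^ Suc m * fps_X ^ Suc s)"
      unfolding * IH by (simp add: algebra_simps del: power_Suc)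
    also have "\<dots> = fps_X ^ (r * (r + 1) div 2) * qpoch_fin (Suc m)"
      unfolding X T q_Suc by (simp add: algebra_simps del: power_Suc)
    finally show ?thesis .
  qed
qed

lemma qpoch_fin_nth_0: "fps_nth (qpoch_fin n) 0 = 1"
  unfolding qpoch_fin_def by (induction n) simp_all

text \<open>The denominator of the Gaussian binomial has constant term 1, so the product form can be
  divided by it. The power of \<open>fps_X\<close> is that of the least possible sum
  \<open>1 + ... + r\<close>.\<close>

lemma subset_gf_eq_qbinom:
  "subset_gf r {1..m} = fps_X ^ (r * (r + 1) div 2) * qbinom m r"
proof (cases "r \<le> m")
  case True
  define D where "D = qpoch_fin r * qpoch_fin (m - r)"
  have D: "fps_nth D 0 \<noteq> 0"
    by (simp add: D_def qpoch_fin_nth_0)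
  then have "qbinom m r * D = qpoch_fin m"
    using True by (simp add: qbinom_def flip: D_def)
  then have "subset_gf r {1..m} * D = fps_X ^ (r * (r + 1) div 2) * qbinom m r * D"
    using subset_gf_mult_qpoch_fin[OF True] by (simp add: D_def mult_ac)
  moreover have "D \<noteq> 0" using D by auto
  ultimately show ?thesis by simp
qed (simp add: subset_gf_eq_0 qbinom_def)

text \<open>Expanding the product means choosing \<open>- (fps_X ^ i)\<close> for \<open>i\<close>
  in \<open>B\<close> and 1 for the other factors.\<close>

lemma prod_one_minus_X_power:
  assumes "finite S"
  shows "(\<Prod>i\<in>S. 1 - fps_X ^ i) = (\<Sum>B\<in>Pow S. (-1) ^ card B * fps_X ^ \<Sum>B :: rat fps)"
proof -
  have "(\<Prod>i\<in>S. 1 - fps_X ^ i :: rat fps) = (\<Prod>i\<in>S. - (fps_X ^ i) + 1)"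
    by simp
  also have "\<dots> = (\<Sum>B\<in>Pow S. (\<Prod>i\<in>B. - (fps_X ^ i)) * (\<Prod>i\<in>S - B. 1))"
    using assms by (rule prod_add)
  also have "\<dots> = (\<Sum>B\<in>Pow S. (-1) ^ card B * fps_X ^ \<Sum>B)"
    by (simp add: prod_uminus power_sum)
  finally show ?thesis .
qed

section \<open>The k-th smallest part as a count\<close>

text \<open>The elements of \<open>P\<close> below \<open>n\<close> form an initial segment of the
  sorted list, so the entry at index \<open>k\<close>, counted from 0, belongs to it exactly when
  the segment has more than \<open>k\<close> elements.\<close>

lemma le_nth_sorted_list_iff:
  fixes P :: "nat set"
  assumes "finite P" "k < card P"
  shows "n \<le> sorted_list_of_set P ! k \<longleftrightarrow> card (P \<inter> {..<n}) \<le> k"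
proof -
  define xs where "xs = sorted_list_of_set P"
  have xs: "set xs = P" "length xs = card P" "sorted_wrt (<) xs" "distinct xs"
    using assms by (auto simp: xs_def)
  show ?thesis
    unfolding xs_def[symmetric]
  proof
    assume n: "n \<le> xs ! k"
    have "P \<inter> {..<n} \<subseteq> (!) xs ` {..<k}"
    proof
      fix x assume x: "x \<in> P \<inter> {..<n}"
      then obtain i where i: "i < length xs" "x = xs ! i"
        using xs(1) by (metis IntD1 in_set_conv_nth)
      have "\<not> k \<le> i"
        using x n i xs(3) sorted_nth_mono[of xs k i] by (auto simp: strict_sorted_imp_sorted)
      then show "x \<in> (!) xs ` {..<k}" using i by auto
    qed
    then have "card (P \<inter> {..<n}) \<le> card ((!) xs ` {..<k})"
      by (intro card_mono) auto
    also have "\<dots> \<le> k" using card_image_le[of "{..<k}" "(!) xs"] by simp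
    finally show "card (P \<inter> {..<n}) \<le> k" .
  next
    assume le: "card (P \<inter> {..<n}) \<le> k"
    show "n \<le> xs ! k"
    proof (rule ccontr)
      assume n: "\<not> n \<le> xs ! k"
      have "(!) xs ` {..k} \<subseteq> P \<inter> {..<n}"
      proof
        fix x assume "x \<in> (!) xs ` {..k}"
        then obtain i where i: "i \<le> k" "x = xs ! i" by auto
        then have "xs ! i \<le> xs ! k"
          using xs assms by (intro sorted_nth_mono) (auto simp: strict_sorted_imp_sorted)
        moreover have "xs ! i \<in> P" using i xs assms by (metis le_less_trans nth_mem)
        ultimately show "x \<in> P \<inter> {..<n}" using n i by auto
      qed
      then have "card ((!) xs ` {..k}) \<le> card (P \<inter> {..<n})"
        using assms by (intro card_mono) auto
      moreover have "card ((!) xs ` {..k}) = Suc k"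
        using xs assms by (subst card_image) (auto intro!: inj_on_nth)
      ultimately show False using le by simp
    qed
  qed
qed

text \<open>A number \<open>s\<close> is the number of \<open>n\<close> in \<open>{1..s}\<close>.
  This turns the weight of a partition into a count, which can later be interchanged with the sum
  over partitions.\<close>

lemma smallest_part_eq_card:
  assumes P: "P \<subseteq> {1..N}" and k: "1 \<le> k" "k \<le> card P"
  shows "smallest_part k P = card {n\<in>{1..N}. card (P \<inter> {..<n}) < k}"
proof -
  have fin: "finite P" using P finite_subset by blast
  have "sorted_list_of_set P ! (k - 1) \<in> P"
    using k fin nth_mem[of "k - 1" "sorted_list_of_set P"] by simp
  then have "sorted_list_of_set P ! (k - 1) \<le> N" using P by auto
  then have "{n\<in>{1..N}. n \<le> sorted_list_of_set P ! (k - 1)} = {1..sorted_list_of_set P ! (k - 1)}"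
    by auto
  moreover have "card (P \<inter> {..<n}) < k \<longleftrightarrow> n \<le> sorted_list_of_set P ! (k - 1)" for n
    using le_nth_sorted_list_iff[OF fin, of "k - 1" n] k by auto
  ultimately show ?thesis using k by (simp only: smallest_part_def card_atLeastAtMost) simp
qed

text \<open>Both sides have the same lower bounds \<open>n\<close>, namely those for which not all
  of \<open>P\<close> lies below \<open>n\<close>; hence they are equal.\<close>

lemma smallest_part_card:
  assumes "finite P" "P \<noteq> {}"
  shows "smallest_part (card P) P = Max P"
proof -
  have "card P > 0" using assms by (simp add: card_gt_0_iff)
  then have *: "n \<le> sorted_list_of_set P ! (card P - 1) \<longleftrightarrow> card (P \<inter> {..<n}) < card P" for n
    using le_nth_sorted_list_iff[of P "card P - 1" n] assms by auto
  have **: "card (P \<inter> {..<n}) < card P \<longleftrightarrow> n \<le> Max P" for n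
  proof
    assume "card (P \<inter> {..<n}) < card P"
    then have "P \<inter> {..<n} \<noteq> P" by (metis less_irrefl)
    then obtain x where "x \<in> P" "n \<le> x" by (metis Int_absorb2 lessThan_iff not_le subsetI)
    then show "n \<le> Max P" using Max_ge[OF assms(1), of x] by linarith
  next
    assume "n \<le> Max P"
    then have "Max P \<notin> P \<inter> {..<n}" "Max P \<in> P" using Max_in[OF assms] by auto
    then have "P \<inter> {..<n} \<subset> P" by blast
    then show "card (P \<inter> {..<n}) < card P" using assms psubset_card_mono by blast
  qed
  have "n \<le> sorted_list_of_set P ! (card P - 1) \<longleftrightarrow> n \<le> Max P" for n
    unfolding * ** ..
  then have "sorted_list_of_set P ! (card P - 1) = Max P"
    by (meson order_antisym order_refl)
  then show ?thesis by (simp add: smallest_part_def)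
qed

text \<open>The condition \<open>P \<inter> {n..} \<noteq> {}\<close> makes the count vanish unless
  \<open>P\<close> has at least \<open>k\<close> elements; in that case it holds for every
  \<open>n\<close> with \<open>k - 1\<close> elements below it. If \<open>card P = k - 1\<close>,
  then \<open>smallest_part k P\<close> takes its default value 0 and only \<open>- Max P\<close>
  remains. For smaller \<open>P\<close> both parts are 0.\<close>

lemma smallest_part_diff:
  assumes P: "P \<subseteq> {1..N}" and k: "2 \<le> k"
  shows "int (smallest_part k P) - int (smallest_part (k - 1) P)
    = int (card {n\<in>{1..N}. card (P \<inter> {..<n}) = k - 1 \<and> P \<inter> {n..} \<noteq> {}})
      - (if card P = k - 1 then int (Max P) else 0)"
proof -
  have fin: "finite P" using P finite_subset by blast
  have split: "card P = card (P \<inter> {..<n}) + card (P \<inter> {n..})" for n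
  proof -
    have "card (P \<inter> {..<n} \<union> P \<inter> {n..}) = card (P \<inter> {..<n}) + card (P \<inter> {n..})"
      using fin by (intro card_Un_disjoint) auto
    moreover have "P \<inter> {..<n} \<union> P \<inter> {n..} = P" by auto
    ultimately show ?thesis by simp
  qed
  have ne: "P \<inter> {n..} \<noteq> {} \<longleftrightarrow> card (P \<inter> {..<n}) < card P" for n
    using split[of n] fin by (auto simp: card_gt_0_iff)
  show ?thesis
  proof (cases "k \<le> card P")
    case True
    define L where "L = (\<lambda>j. {n\<in>{1..N}. card (P \<inter> {..<n}) < j})"
    have L: "L k = L (k - 1) \<union> {n\<in>{1..N}. card (P \<inter> {..<n}) = k - 1 \<and> P \<inter> {n..} \<noteq> {}}"
      (is "_ = _ \<union> ?D")
      unfolding ne L_def using True k by auto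
    have "card (L k) = card (L (k - 1)) + card ?D"
      unfolding L by (rule card_Un_disjoint) (auto simp: L_def)
    then show ?thesis
      using smallest_part_eq_card[OF P, of k] smallest_part_eq_card[OF P, of "k - 1"] True k
      by (simp add: L_def)
  next
    case False
    then have D: "{n\<in>{1..N}. card (P \<inter> {..<n}) = k - 1 \<and> P \<inter> {n..} \<noteq> {}} = {}"
      unfolding ne by auto
    show ?thesis
    proof (cases "card P = k - 1")
      case True
      then have "P \<noteq> {}" using k by auto
      then show ?thesis
        unfolding D using True False smallest_part_card[OF fin]
        by (simp add: smallest_part_def[of k])
    qed (unfold D, use False in \<open>simp add: smallest_part_def\<close>)
  qed
qed


section \<open>The identity for subsets of \<open>{1..N}\<close>\<close>

text \<open>Cutting \<open>P\<close> at \<open>n\<close> is a bijection onto pairs of an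
  \<open>r\<close>-subset of \<open>{1..<n}\<close> and a nonempty subset of \<open>{n..N}\<close>.
  The signed weight is multiplicative along the cut, and the lower piece always has sign
  \<open>(-1) ^ r\<close>.\<close>

lemma sum_split_at:
  assumes "n \<in> {1..N}"
  shows "(\<Sum>P | P \<in> Pow {1..N} \<and> card (P \<inter> {..<n}) = r \<and> P \<inter> {n..} \<noteq> {}.
      (-1) ^ card P * fps_X ^ \<Sum>P :: rat fps)
    = (-1) ^ r * subset_gf r {1..<n} * ((\<Prod>i=n..N. 1 - fps_X ^ i) - 1)"
proof -
  define \<A> where "\<A> = {A. A \<subseteq> {1..<n} \<and> card A = r}"
  define \<B> where "\<B> = Pow {n..N} - {{}}"
  have fin: "finite \<A>" "finite \<B>" by (auto simp: \<A>_def \<B>_def)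
  \<comment> \<open>Subtracting 1 removes the contribution of the empty upper piece.\<close>
  have "(\<Prod>i=n..N. 1 - fps_X ^ i) - 1 = (\<Sum>B\<in>\<B>. (-1) ^ card B * fps_X ^ \<Sum>B :: rat fps)"
    by (simp add: prod_one_minus_X_power \<B>_def sum_diff1)
  then have "(-1) ^ r * subset_gf r {1..<n} * ((\<Prod>i=n..N. 1 - fps_X ^ i) - 1)
      = (-1) ^ r * (\<Sum>(A, B)\<in>\<A> \<times> \<B>. fps_X ^ \<Sum>A * ((-1) ^ card B * fps_X ^ \<Sum>B))"
    by (simp add: subset_gf_def mult.assoc sum_product sum.cartesian_product \<A>_def)
  also have "\<dots> = (\<Sum>(A, B)\<in>\<A> \<times> \<B>. (-1) ^ r * (fps_X ^ \<Sum>A * ((-1) ^ card B * fps_X ^ \<Sum>B)))"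
    by (simp add: sum_distrib_left case_prod_beta)
  also have "\<dots> = (\<Sum>P | P \<in> Pow {1..N} \<and> card (P \<inter> {..<n}) = r \<and> P \<inter> {n..} \<noteq> {}.
      (-1) ^ card P * fps_X ^ \<Sum>P)"
  proof (rule sum.reindex_bij_witness
      [where i = "\<lambda>P. (P \<inter> {..<n}, P \<inter> {n..})" and j = "\<lambda>(A, B). A \<union> B"], goal_cases)
    case (1 a)
    then show ?case by (auto simp: \<A>_def \<B>_def)
  next
    case (2 a)
    then obtain A B where AB: "a = (A, B)" "A \<subseteq> {1..<n}" "card A = r" "B \<subseteq> {n..N}" "B \<noteq> {}"
      by (auto simp: \<A>_def \<B>_def)
    then have "(A \<union> B) \<inter> {..<n} = A" "(A \<union> B) \<inter> {n..} = B" by auto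
    moreover have "A \<union> B \<subseteq> {1..N}" using AB assms by fastforce
    ultimately show ?case using AB by simp
  next
    case (3 b)
    then show ?case by auto
  next
    case (4 b)
    then show ?case by (fastforce simp: \<A>_def \<B>_def)
  next
    case (5 a)
    then obtain A B where AB: "a = (A, B)" "A \<subseteq> {1..<n}" "card A = r" "B \<subseteq> {n..N}" 
      by (auto simp: \<A>_def \<B>_def)
    then have "finite A" "finite B" "A \<inter> B = {}"
      by (auto dest: finite_subset) (meson atLeastAtMost_iff atLeastLessThan_iff in_mono not_le)
    then show ?case using AB by (simp add: card_Un_disjoint sum.union_disjoint power_add)
  qed
  finally show ?thesis by simp
qed

text \<open>The correspondence is \<open>P\<close> to \<open>(Max P, P - {Max P})\<close>. The
  cardinality \<open>Suc r\<close> guarantees that \<open>P\<close> is nonempty, so that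
  \<open>Max P\<close> is an element of it.\<close>

lemma sum_Max_subset_gf:
  "(\<Sum>P | P \<in> Pow {1..N} \<and> card P = Suc r. of_nat (Max P) * fps_X ^ \<Sum>P)
    = (\<Sum>n=1..N. subset_gf r {1..<n} * (of_nat n * fps_X ^ n))"
proof -
  define \<A> where "\<A> = (\<lambda>n::nat. {A. A \<subseteq> {1..<n} \<and> card A = r})"
  have "(\<Sum>n=1..N. subset_gf r {1..<n} * (of_nat n * fps_X ^ n))
      = (\<Sum>(n, A)\<in>(SIGMA n:{1..N}. \<A> n). fps_X ^ \<Sum>A * (of_nat n * fps_X ^ n))"
    by (subst sum.Sigma[symmetric]) (auto simp: subset_gf_def \<A>_def sum_distrib_right)
  also have "\<dots> = (\<Sum>P | P \<in> Pow {1..N} \<and> card P = Suc r. of_nat (Max P) * fps_X ^ \<Sum>P)"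
  proof (rule sum.reindex_bij_witness
      [where i = "\<lambda>P. (Max P, P - {Max P})" and j = "\<lambda>(n, A). insert n A"], goal_cases)
    case (1 a)
    then obtain n A where a: "a = (n, A)" "A \<subseteq> {1..<n}"
      by (auto simp: \<A>_def)
    then have "Max (insert n A) = n" by (intro Max_eqI) (auto dest: finite_subset)
    with a show ?case by auto
  next
    case (2 a)
    then obtain n A where a: "a = (n, A)" "A \<subseteq> {1..<n}" "n \<in> {1..N}" "card A = r"
      by (auto simp: \<A>_def)
    then have "finite A" "n \<notin> A" by (auto dest: finite_subset)
    with a show ?case by auto
  next
    case (3 P)
    then have "finite P" "P \<noteq> {}" by (auto dest: finite_subset)
    then show ?case using Max_in by auto
  next
    case (4 P)
    then have P: "finite P" "P \<noteq> {}" "P \<subseteq> {1..N}" "card P = Suc r" by (auto dest: finite_subset)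
    have "P - {Max P} \<subseteq> {1..<Max P}"
    proof
      fix x assume "x \<in> P - {Max P}"
      then have "x \<in> {1..N}" "x \<le> Max P" "x \<noteq> Max P" using P by auto
      then show "x \<in> {1..<Max P}" by simp
    qed
    moreover have "Max P \<in> P" using P by simp
    moreover from this have "Max P \<in> {1..N}" using P by blast
    ultimately show ?case using P by (simp add: \<A>_def)
  next
    case (5 a)
    then obtain n A where a: "a = (n, A)" "A \<subseteq> {1..<n}"
      by (auto simp: \<A>_def)
    then have "Max (insert n A) = n" by (intro Max_eqI) (auto dest: finite_subset)
    moreover have "finite A" "n \<notin> A" using a by (auto dest: finite_subset)
    ultimately show ?case using a by (simp add: power_add mult_ac)
  qed
  finally show ?thesis by simp
qed

text \<open>This is the finite form of the theorem, with both sums and the infinite products cut off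
  at \<open>N\<close>. It follows by summing the pointwise difference over all \<open>P\<close> and
  interchanging the summations.\<close>

lemma sum_smallest_part_diff:
  assumes k: "2 \<le> k"
  shows "(\<Sum>P\<in>Pow {1..N}. (-1) ^ card P * fps_X ^ \<Sum>P
      * of_int (int (smallest_part k P) - int (smallest_part (k - 1) P)))
    = (-1) ^ (k - 1) * (\<Sum>n=1..N. subset_gf (k - 1) {1..<n} * ((\<Prod>i=n..N. 1 - fps_X ^ i) - 1))
      - (-1) ^ (k - 1) * (\<Sum>n=1..N. subset_gf (k - 2) {1..<n} * (of_nat n * fps_X ^ n))"
proof -
  define w :: "nat set \<Rightarrow> rat fps" where "w P = (-1) ^ card P * fps_X ^ \<Sum>P" for P
  define R where "R P n \<longleftrightarrow> card (P \<inter> {..<n}) = k - 1 \<and> P \<inter> {n..} \<noteq> {}" for P :: "nat set" and n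
  have Suc: "k - 1 = Suc (k - 2)" using k by simp
  have "(\<Sum>P\<in>Pow {1..N}. w P * of_int (int (smallest_part k P) - int (smallest_part (k - 1) P)))
      = (\<Sum>P\<in>Pow {1..N}. (\<Sum>n | n \<in> {1..N} \<and> R P n. w P)
          - (if card P = k - 1 then w P * of_nat (Max P) else 0))"
  proof (rule sum.cong)
    fix P assume "P \<in> Pow {1..N}"
    then have *: "int (smallest_part k P) - int (smallest_part (k - 1) P)
        = int (card {n\<in>{1..N}. R P n}) - (if card P = k - 1 then int (Max P) else 0)"
      unfolding R_def using k by (intro smallest_part_diff) auto
    show "w P * of_int (int (smallest_part k P) - int (smallest_part (k - 1) P))
      = (\<Sum>n | n \<in> {1..N} \<and> R P n. w P) - (if card P = k - 1 then w P * of_nat (Max P) else 0)"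
      unfolding * by (simp add: algebra_simps)
  qed simp
  \<comment> \<open>Interchange of summations: instead of counting the admissible \<open>n\<close>
    for each \<open>P\<close>, the sets \<open>P\<close> admitting a given \<open>n\<close> are
    collected.\<close>
  also have "\<dots> = (\<Sum>n\<in>{1..N}. \<Sum>P | P \<in> Pow {1..N} \<and> R P n. w P)
      - (\<Sum>P\<in>Pow {1..N}. if card P = k - 1 then w P * of_nat (Max P) else 0)"
    unfolding sum_subtractf by (subst sum.swap_restrict) auto
  also have "(\<Sum>P\<in>Pow {1..N}. if card P = k - 1 then w P * of_nat (Max P) else 0)
      = (\<Sum>P | P \<in> Pow {1..N} \<and> card P = k - 1. w P * of_nat (Max P))"
    by (rule sum.inter_filter[symmetric]) simp
  also have "\<dots> = (-1) ^ (k - 1) * (\<Sum>P | P \<in> Pow {1..N} \<and> card P = k - 1. of_nat (Max P) * fps_X ^ \<Sum>P)"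
    unfolding sum_distrib_left by (rule sum.cong) (auto simp: w_def mult_ac)
  also have "(\<Sum>P | P \<in> Pow {1..N} \<and> card P = k - 1. of_nat (Max P) * fps_X ^ \<Sum>P)
      = (\<Sum>n=1..N. subset_gf (k - 2) {1..<n} * (of_nat n * fps_X ^ n))"
    unfolding Suc by (rule sum_Max_subset_gf)
  also have "(\<Sum>n\<in>{1..N}. \<Sum>P | P \<in> Pow {1..N} \<and> R P n. w P)
      = (-1) ^ (k - 1) * (\<Sum>n=1..N. subset_gf (k - 1) {1..<n} * ((\<Prod>i=n..N. 1 - fps_X ^ i) - 1))"
    unfolding sum_distrib_left w_def R_def
    by (rule sum.cong) (simp_all only: sum_split_at mult.assoc)
  finally show ?thesis unfolding w_def .
qed

section \<open>Coefficients of the generating function\<close>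

text \<open>Partitions of \<open>N\<close> into distinct parts are exactly the subsets of
  \<open>{1..N}\<close> with sum \<open>N\<close>; all other subsets contribute only to other
  coefficients.\<close>

lemma FFW_gf_nth:
  assumes "1 \<le> k"
  shows "fps_nth (FFW_gf k) N
    = fps_nth (\<Sum>P\<in>Pow {1..N}. (-1) ^ card P * fps_X ^ \<Sum>P * of_int (int (smallest_part k P))) N"
proof -
  have D: "distinct_partitions N = {P \<in> Pow {1..N}. \<Sum>P = N}"
  proof (intro equalityI subsetI)
    fix P assume "P \<in> distinct_partitions N"
    then have P: "finite P" "0 \<notin> P" "\<Sum>P = N" by (auto simp: distinct_partitions_def)
    have "x \<in> {1..N}" if "x \<in> P" for x
      using member_le_sum[OF that, of "\<lambda>x. x"] P that by (cases x) auto
    with P show "P \<in> {P \<in> Pow {1..N}. \<Sum>P = N}" by auto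
  qed (auto simp: distinct_partitions_def dest: finite_subset)
  have coeff: "fps_nth ((-1) ^ card P * fps_X ^ \<Sum>P * of_int j :: rat fps) N
      = (if \<Sum>P = N then of_int ((-1) ^ card P * j) else 0)" for P :: "nat set" and j
  proof -
    \<comment> \<open>Sign and weight are gathered in one constant, so that the coefficient of a
      monomial can be read off.\<close>
    have "(-1) ^ card P * fps_X ^ \<Sum>P * of_int j
        = (fps_const (of_int ((-1) ^ card P * j)) * fps_X ^ \<Sum>P :: rat fps)"
      by (cases "even (card P)") (simp_all add: mult_ac flip: fps_of_int fps_const_neg)
    then show ?thesis by (simp only: fps_mult_left_const_nth fps_X_power_nth) simp
  qed
  have "of_int (FFW k N) = fps_nth (\<Sum>P\<in>Pow {1..N}. (-1) ^ card P * fps_X ^ \<Sum>P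
      * of_int (int (smallest_part k P)) :: rat fps) N"
    unfolding fps_sum_nth coeff FFW_def D of_int_sum by (rule sum.inter_filter) simp
  \<comment> \<open>The constant term of \<open>FFW_gf\<close> is 0 by definition. It agrees with
    the sum because the empty partition has fewer than \<open>k\<close> parts for
    \<open>k \<ge> 1\<close>.\<close>
  moreover have "FFW k 0 = 0"
  proof -
    have "P = {}" if "P \<in> distinct_partitions 0" for P
      using that by (auto simp: distinct_partitions_def)
    then have "smallest_part k P = 0" if "P \<in> distinct_partitions 0" for P
      using that assms by (fastforce simp: smallest_part_def)
    then show ?thesis by (simp add: FFW_def)
  qed
  ultimately show ?thesis by (cases "N = 0") (simp_all add: FFW_gf_def)
qed

section \<open>Power series up to degree \<open>N\<close>\<close>

text \<open>Congruence modulo \<open>fps_X ^ (N + 1)\<close>. Equality of the coefficients of degree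
  \<open>N\<close> alone would not be compatible with products.\<close>

definition fps_agree :: "nat \<Rightarrow> 'a::zero fps \<Rightarrow> 'a fps \<Rightarrow> bool" where
  "fps_agree N f g \<longleftrightarrow> (\<forall>m\<le>N. fps_nth f m = fps_nth g m)"

lemma fps_agree_refl [simp]: "fps_agree N f f"
  by (simp add: fps_agree_def)

lemma fps_agree_trans [trans]: "fps_agree N f g \<Longrightarrow> fps_agree N g h \<Longrightarrow> fps_agree N f h"
  by (simp add: fps_agree_def)

lemma fps_agree_mult:
  fixes f g :: "'a::semiring_0 fps"
  shows "fps_agree N f f' \<Longrightarrow> fps_agree N g g' \<Longrightarrow> fps_agree N (f * g) (f' * g')"
  unfolding fps_agree_def fps_mult_nth by (auto intro!: sum.cong)

lemma fps_agree_diff: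
  fixes f g :: "'a::ab_group_add fps"
  shows "fps_agree N f f' \<Longrightarrow> fps_agree N g g' \<Longrightarrow> fps_agree N (f - g) (f' - g')"
  by (simp add: fps_agree_def)

lemma fps_agree_sum:
  fixes f g :: "'b \<Rightarrow> 'a::comm_monoid_add fps"
  assumes "\<And>x. x \<in> S \<Longrightarrow> fps_agree N (f x) (g x)"
  shows "fps_agree N (sum f S) (sum g S)"
  unfolding fps_agree_def fps_sum_nth
proof (intro allI impI sum.cong refl)
  fix m x assume "m \<le> N" "x \<in> S"
  then show "fps_nth (f x) m = fps_nth (g x) m"
    using assms unfolding fps_agree_def by blast
qed

text \<open>Convergence of power series makes each coefficient of the partial sums eventually
  constant, and summands with index above \<open>N\<close> do not change coefficients up to degree
  \<open>N\<close>.\<close>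

lemma fps_agree_suminf:
  fixes f :: "nat \<Rightarrow> 'a::ab_group_add fps"
  assumes vanish: "\<And>m n. m < n \<Longrightarrow> fps_nth (f n) m = 0"
  shows "fps_agree N (suminf f) (\<Sum>n\<le>N. f n)"
  unfolding fps_agree_def
proof (intro allI impI)
  fix m assume "m \<le> N"
  have "(\<lambda>M. \<Sum>n<M. f n) \<longlonglongrightarrow> suminf f"
    using summable_LIMSEQ[OF summable_fps] vanish by blast
  then have "eventually (\<lambda>M. fps_nth (\<Sum>n<M. f n) m = fps_nth (suminf f) m) sequentially"
    unfolding tendsto_fps_iff by blast
  then obtain M0 where M0: "\<And>M. M \<ge> M0 \<Longrightarrow> fps_nth (\<Sum>n<M. f n) m = fps_nth (suminf f) m"
    unfolding eventually_sequentially by blast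
  \<comment> \<open>Large enough for the coefficient to have stabilised and for
    \<open>{..<M}\<close> to contain \<open>{..N}\<close>.\<close>
  define M where "M = max M0 (Suc N)"
  have "fps_nth (suminf f) m = (\<Sum>n<M. fps_nth (f n) m)"
    using M0[of M] by (simp add: M_def fps_sum_nth)
  also have "\<dots> = (\<Sum>n\<le>N. fps_nth (f n) m)"
    by (rule sum.mono_neutral_right) (use \<open>m \<le> N\<close> in \<open>auto simp: M_def intro!: vanish\<close>)
  finally show "fps_nth (suminf f) m = fps_nth (\<Sum>n\<le>N. f n) m"
    by (simp add: fps_sum_nth)
qed

text \<open>A factor \<open>1 - fps_X ^ i\<close> with \<open>i > N\<close> leaves coefficients up
  to degree \<open>N\<close> unchanged. For \<open>n > N\<close> the finite product is empty and
  equals 1.\<close>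

lemma fps_agree_qpoch_inf:
  assumes "1 \<le> n"
  shows "fps_agree N (qpoch_inf (fps_X ^ n)) (\<Prod>i=n..N. 1 - fps_X ^ i)"
  unfolding fps_agree_def
proof (intro allI impI)
  fix m assume m: "m \<le> N"
  define P :: "nat \<Rightarrow> rat fps" where "P M = (\<Prod>i=n..M. 1 - fps_X ^ i)" for M
  have stable: "fps_nth (P M) m = fps_nth (P N) m" if "N \<le> M" for M
    using that
  proof (induction M rule: dec_induct)
    case (step M)
    show ?case
    proof (cases "n \<le> Suc M")
      case True
      then have "P (Suc M) = P M - P M * fps_X ^ Suc M"
        by (simp add: P_def algebra_simps)
      then show ?thesis
        using step m by (simp add: fps_X_power_mult_right_nth del: power_Suc)
    qed (use step in \<open>simp add: P_def\<close>)
  qed simp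
  \<comment> \<open>The infinite product is indexed from 0, so its partial products are the
    \<open>P\<close> shifted by \<open>n\<close>.\<close>
  have "(\<Prod>i\<le>M. 1 - fps_X ^ n * fps_X ^ i) = P (M + n)" for M
  proof -
    have "P (M + n) = (\<Prod>i=0..M. 1 - fps_X ^ (i + n))"
      unfolding P_def using prod.shift_bounds_cl_nat_ivl[of _ 0 n M] by simp
    then show ?thesis by (simp add: power_add mult.commute atLeast0AtMost)
  qed
  then have "(\<lambda>M. P (M + n)) \<longlonglongrightarrow> qpoch_inf (fps_X ^ n)"
    using qpoch_inf_has_prod(2)[of "fps_X ^ n"] assms by simp
  then have "eventually (\<lambda>M. fps_nth (P (M + n)) m = fps_nth (qpoch_inf (fps_X ^ n)) m) sequentially"
    unfolding tendsto_fps_iff by blast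
  then obtain M0 where M0: "\<And>M. M \<ge> M0 \<Longrightarrow> fps_nth (P (M + n)) m = fps_nth (qpoch_inf (fps_X ^ n)) m"
    unfolding eventually_sequentially by blast
  show "fps_nth (qpoch_inf (fps_X ^ n)) m = fps_nth (\<Prod>i=n..N. 1 - fps_X ^ i) m"
    using M0[of "max M0 N"] stable[of "max M0 N + n"] by (simp add: P_def)
qed

text \<open>The summands of the left-hand sum start at \<open>g (r + 1)\<close>; the right-hand sum may start at
  \<open>n = 1\<close> because \<open>{1..<n}\<close> has no \<open>r\<close>-subset for \<open>n \<le> r\<close>.\<close>

lemma fps_agree_suminf_qbinom:
  fixes g :: "nat \<Rightarrow> rat fps"
  assumes vanish: "\<And>m n. m < n \<Longrightarrow> fps_nth (g n) m = 0"
    and agree: "\<And>n. 1 \<le> n \<Longrightarrow> fps_agree N (g n) (h n)"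
  shows "fps_agree N (fps_X ^ (Suc r * r div 2) * (\<Sum>n. qbinom (n + r) r * g (n + Suc r)))
    (\<Sum>n=1..N. subset_gf r {1..<n} * h n)"
proof -
  define c :: "rat fps" where "c = fps_X ^ (Suc r * r div 2)"
  \<comment> \<open>Indexed by the true summation variable, \<open>F n\<close> vanishes below degree
    \<open>n\<close>. This allows truncation both before and after the index shift by
    \<open>Suc r\<close>.\<close>
  define F where "F n = qbinom (n - 1) r * g n" for n
  have F_vanish: "fps_nth (F n) m = 0" if "m < n" for m n
    unfolding F_def fps_mult_nth using that vanish by (auto intro!: sum.neutral)
  have F: "qbinom (n + r) r * g (n + Suc r) = F (n + Suc r)" for n
    by (simp add: F_def)
  have "fps_agree N (\<Sum>n. F (n + Suc r)) (\<Sum>n\<le>N. F (n + Suc r))"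
    by (rule fps_agree_suminf) (simp add: F_vanish)
  also have "(\<Sum>n\<le>N. F (n + Suc r)) = (\<Sum>n=Suc r..N + Suc r. F n)"
    using sum.shift_bounds_cl_nat_ivl[of F 0 "Suc r" N] by (simp add: atLeast0AtMost)
  also have "\<dots> = (\<Sum>n=1..N + Suc r. F n)"
    by (rule sum.mono_neutral_left) (auto simp: F_def qbinom_def)
  also have "fps_agree N (\<Sum>n=1..N + Suc r. F n) (\<Sum>n=1..N. F n)"
  proof -
    have "(\<Sum>n=1..N + Suc r. fps_nth (F n) m) = (\<Sum>n=1..N. fps_nth (F n) m)" if "m \<le> N" for m
      by (rule sum.mono_neutral_right) (use that in \<open>auto intro!: F_vanish\<close>)
    then show ?thesis by (simp add: fps_agree_def fps_sum_nth)
  qed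
  finally have "fps_agree N (c * (\<Sum>n. F (n + Suc r))) (c * (\<Sum>n=1..N. F n))"
    by (intro fps_agree_mult) simp_all
  also have "c * (\<Sum>n=1..N. F n) = (\<Sum>n=1..N. subset_gf r {1..<n} * g n)"
    unfolding sum_distrib_left
  proof (rule sum.cong)
    fix n assume "n \<in> {1..N}"
    then have "{1..<n} = {1..n - 1}" by auto
    then show "c * F n = subset_gf r {1..<n} * g n"
      by (simp add: subset_gf_eq_qbinom[of r "n - 1", simplified] c_def F_def mult.commute mult.left_commute)
  qed simp
  also have "fps_agree N \<dots> (\<Sum>n=1..N. subset_gf r {1..<n} * h n)"
    by (intro fps_agree_sum fps_agree_mult agree) auto
  finally show ?thesis unfolding F c_def .
qed

section \<open>From the finite identity to power series\<close>

theorem theorem4p3: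
  fixes k :: nat
  assumes "k \<ge> 2"
  shows "FFW_gf k = FFW_gf (k - 1)
    + (-1) ^ (k - 1) * fps_X ^ (k * (k - 1) div 2)
        * (\<Sum>n. qbinom (n + k - 1) (k - 1) * (qpoch_inf (fps_X ^ (n + k)) - 1))
    - (-1) ^ (k - 1) * fps_X ^ ((k - 1) * (k - 2) div 2)
        * (\<Sum>n. qbinom (n + (k - 1) - 1) (k - 2)
                  * (of_nat (n + (k - 1)) * fps_X ^ (n + (k - 1))))"
proof (rule fps_ext)
  fix N
  have Suc: "k = Suc (k - 1)" "k - 1 = Suc (k - 2)" using assms by simp_all
  define S where "S j = (\<Sum>P\<in>Pow {1..N}. (-1) ^ card P * fps_X ^ \<Sum>P * of_int (int (smallest_part j P)) :: rat fps)" for j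
  define A where "A = fps_X ^ (k * (k - 1) div 2)
        * (\<Sum>n. qbinom (n + k - 1) (k - 1) * (qpoch_inf (fps_X ^ (n + k)) - 1))"
  define B where "B = fps_X ^ ((k - 1) * (k - 2) div 2)
        * (\<Sum>n. qbinom (n + (k - 1) - 1) (k - 2) * (of_nat (n + (k - 1)) * fps_X ^ (n + (k - 1))))"
  \<comment> \<open>\<open>A'\<close> and \<open>B'\<close> are the truncated sums of the finite
    identity, which agree with \<open>A\<close> and \<open>B\<close> up to degree
    \<open>N\<close>.\<close>
  define A' where "A' = (\<Sum>n=1..N. subset_gf (k - 1) {1..<n} * ((\<Prod>i=n..N. 1 - fps_X ^ i) - 1))"
  define B' where "B' = (\<Sum>n=1..N. subset_gf (k - 2) {1..<n} * (of_nat n * fps_X ^ n))"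
  \<comment> \<open>Taking \<open>r = k - 1\<close> gives the index shift \<open>Suc r = k\<close>
    and the exponent \<open>k * (k - 1) div 2\<close>.\<close>
  have A: "fps_agree N A A'"
    using fps_agree_suminf_qbinom[of "\<lambda>n. qpoch_inf (fps_X ^ n) - 1" N
        "\<lambda>n. (\<Prod>i=n..N. 1 - fps_X ^ i) - 1" "k - 1"] assms
    by (simp add: A_def A'_def fps_nth_qpoch_inf_minus_1 fps_agree_diff fps_agree_qpoch_inf
        flip: Suc del: fps_sub_nth)
  have B: "fps_agree N B B'"
  proof -
    \<comment> \<open>Here \<open>r = k - 2\<close>; the truncated subtraction is harmless because
      \<open>k \<ge> 2\<close>.\<close>
    have "n + (k - 1) - 1 = n + (k - 2)" for n using assms by simp
    then show ?thesis
      using fps_agree_suminf_qbinom[of "\<lambda>n. of_nat n * fps_X ^ n" N "\<lambda>n. of_nat n * fps_X ^ n" "k - 2"]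
      unfolding B_def B'_def Suc(2)[symmetric] by (simp only: fps_X_power_mult_right_nth fps_agree_refl simp_thms if_True)
  qed
  have "S k - S (k - 1) = (-1) ^ (k - 1) * A' - (-1) ^ (k - 1) * B'"
    using sum_smallest_part_diff[OF assms, of N]
    by (simp add: S_def A'_def B'_def right_diff_distrib sum_subtractf)
  moreover have "fps_agree N ((-1) ^ (k - 1) * A - (-1) ^ (k - 1) * B) ((-1) ^ (k - 1) * A' - (-1) ^ (k - 1) * B')"
    using A B by (intro fps_agree_diff fps_agree_mult) simp_all
  ultimately have "fps_nth ((-1) ^ (k - 1) * A - (-1) ^ (k - 1) * B) N = fps_nth (S k) N - fps_nth (S (k - 1)) N"
    by (simp add: fps_agree_def flip: fps_sub_nth)
  also have "\<dots> = fps_nth (FFW_gf k) N - fps_nth (FFW_gf (k - 1)) N"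
    using assms by (simp add: FFW_gf_nth S_def)
  finally show "fps_nth (FFW_gf k) N = fps_nth (FFW_gf (k - 1)
    + (-1) ^ (k - 1) * fps_X ^ (k * (k - 1) div 2)
        * (\<Sum>n. qbinom (n + k - 1) (k - 1) * (qpoch_inf (fps_X ^ (n + k)) - 1))
    - (-1) ^ (k - 1) * fps_X ^ ((k - 1) * (k - 2) div 2)
        * (\<Sum>n. qbinom (n + (k - 1) - 1) (k - 2)
                  * (of_nat (n + (k - 1)) * fps_X ^ (n + (k - 1))))) N"
    by (simp add: A_def B_def mult.assoc)
qed

end
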